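(* Assume that the Kac–Moody matrix of the root generating system is an indefinite Kac–Moody matrix of size $3$, that there exists a non-spherical positive vectorial face different from $\mathbb A_{in}$, and that $(\alpha_s^\vee)_{s\in\mathscr S}$ is a basis of $\mathbb A$. Then $$\mathrm{Hom}_{\mathrm{Mon}}\big(Y^+,(\mathcal F,\cdot)\big)\supsetneq\mathrm{Hom}_{\mathrm{Mon}}(Y^+,\mathcal F^* )\cup\{0\}.$$
   Context: Let $(A,X,Y,(\alpha_i)_{i\in I},(\alpha_i^\vee)_{i\in I})$ be a root generating system: $A=(a_{i,j})$ is a Kac–Moody matrix (finite index set $I$, integer entries, $a_{i,i}=2$, $a_{i,j}\le 0$ for $i\ne j$, $a_{i,j}=0\iff a_{j,i}=0$), $X,Y$ are dual free $\mathbb Z$-modules of finite rank, $(\alpha_i)$ and $(\alpha_i^\vee)$ are free families in $X$ and $Y$ with $\alpha_j(\alpha_i^\vee)=a_{i,j}$. "Indefinite" is meant in the sense of Kac's classification of indecomposable generalized Cartan matrices into finite, affine and indefinite type. Put $\mathbb A=Y\otimes\mathbb R$, $r_i(v)=v-\alpha_i(v)\alpha_i^\vee$, $\mathscr S=\{r_i\}$, $W^v=\langle\mathscr S\rangle\subset GL(\mathbb A)$; for $s=r_i$ write $\alpha_s=\alpha_i$, $\alpha_s^\vee=\alpha_i^\vee$. Let $C^v_f=\{v\in\mathbb A\mid\alpha_s(v)>0\ \forall s\}$, $\mathcal T=\bigcup_{w\in W^v}w.\overline{C^v_f}$ (Tits cone), $Y^+=Y\cap\mathcal T$, $\mathbb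 A_{in}=\bigcap_{s\in\mathscr S}\ker\alpha_s$. For $J\subset\mathscr S$, $F^v(J)=\{x\in\mathbb A\mid\alpha_j(x)=0\ \forall j\in J,\ \alpha_j(x)>0\ \forall j\in\mathscr S\setminus J\}$; a positive vectorial face is a set $w.F^v(J)$, $w\in W^v$, $J\subset\mathscr S$; it is spherical if its (pointwise) fixator in $W^v$ is finite. $\mathcal F$ is a field of characteristic $0$. $\mathrm{Hom}_{\mathrm{Mon}}(Y^+,(\mathcal F,\cdot))$ is the set of maps $\tau:Y^+\to\mathcal F$ with $\tau(\lambda+\mu)=\tau(\lambda)\tau(\mu)$ for all $\lambda,\mu$ (the zero map $0$ is allowed), and $\mathrm{Hom}_{\mathrm{Mon}}(Y^+,\mathcal F^* )$ is the subset of those with values in $\mathcal F^*$. *)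

theory Defs
  imports "HOL-Analysis.Analysis"
begin

section \<open>Kac--Moody matrices\<close>

definition kac_moody_matrix :: "'i set \<Rightarrow> ('i \<Rightarrow> 'i \<Rightarrow> int) \<Rightarrow> bool" where
  "kac_moody_matrix I a \<longleftrightarrow>
     finite I \<and>
     (\<forall>i\<in>I. a i i = 2) \<and>
     (\<forall>i\<in>I. \<forall>j\<in>I. i \<noteq> j \<longrightarrow> a i j \<le> 0) \<and>
     (\<forall>i\<in>I. \<forall>j\<in>I. a i j = 0 \<longleftrightarrow> a j i = 0)"

definition indecomposable :: "'i set \<Rightarrow> ('i \<Rightarrow> 'i \<Rightarrow> int) \<Rightarrow> bool" where
  "indecomposable I a \<longleftrightarrow>
     \<not> (\<exists>K L. K \<noteq> {} \<and> L \<noteq> {} \<and> K \<inter> L = {} \<and> K \<union> L = I \<and>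
            (\<forall>i\<in>K. \<forall>j\<in>L. a i j = 0 \<and> a j i = 0))"

definition mat_vec :: "'i set \<Rightarrow> ('i \<Rightarrow> 'i \<Rightarrow> int) \<Rightarrow> ('i \<Rightarrow> real) \<Rightarrow> 'i \<Rightarrow> real" where
  "mat_vec I a u i = (\<Sum>j\<in>I. of_int (a i j) * u j)"

text \<open>
  This is case (Ind) of the trichotomy (Fin), (Aff), (Ind) by which Kac (\<^emph>\<open>Infinite dimensional
  Lie algebras\<close>, Theorem 4.3) defines the type of an indecomposable matrix.
\<close>

definition indefinite_type :: "'i set \<Rightarrow> ('i \<Rightarrow> 'i \<Rightarrow> int) \<Rightarrow> bool" where
  "indefinite_type I a \<longleftrightarrow>
     kac_moody_matrix I a \<and> indecomposable I a \<and>
     (\<exists>u. (\<forall>i\<in>I. u i > 0) \<and> (\<forall>i\<in>I. mat_vec I a u i < 0)) \<and>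
     (\<forall>v. (\<forall>i\<in>I. mat_vec I a v i \<ge> 0) \<and> (\<forall>i\<in>I. v i \<ge> 0) \<longrightarrow> (\<forall>i\<in>I. v i = 0))"

section \<open>Root generating systems\<close>

text \<open>
  The ambient type \<open>'v\<close> plays the role of \<open>Y \<otimes> \<real>\<close>: the free module \<open>Y\<close> is the
  \<open>\<int>\<close>-span of an \<open>\<real>\<close>-basis of \<open>'v\<close>, and \<open>X\<close> is its dual, whose elements are identified with
  their \<open>\<real>\<close>-linear extensions to \<open>'v\<close>. Of the Euclidean structure of \<open>'v\<close> only finite dimension
  and the (canonical) topology are used.
\<close>

definition full_lattice :: "'v::euclidean_space set \<Rightarrow> bool" where
  "full_lattice Y \<longleftrightarrow>
     (\<exists>B. independent B \<and> span B = UNIV \<and> Y = range (\<lambda>c. \<Sum>b\<in>B. of_int (c b) *\<^sub>R b))"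

definition dual_lattice :: "'v::euclidean_space set \<Rightarrow> ('v \<Rightarrow> real) set" where
  "dual_lattice Y = {f. linear f \<and> (\<forall>y\<in>Y. f y \<in> \<int>)}"

definition root_generating_system ::
  "'i set \<Rightarrow> ('i \<Rightarrow> 'i \<Rightarrow> int) \<Rightarrow> ('v::euclidean_space \<Rightarrow> real) set \<Rightarrow> 'v set \<Rightarrow>
     ('i \<Rightarrow> 'v \<Rightarrow> real) \<Rightarrow> ('i \<Rightarrow> 'v) \<Rightarrow> bool" where
  "root_generating_system I a X Y \<alpha> \<alpha>v \<longleftrightarrow>
     kac_moody_matrix I a \<and>
     full_lattice Y \<and> X = dual_lattice Y \<and>
     (\<forall>i\<in>I. \<alpha> i \<in> X) \<and> (\<forall>i\<in>I. \<alpha>v i \<in> Y) \<and>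
     (\<forall>c::'i \<Rightarrow> int. (\<forall>v. (\<Sum>i\<in>I. of_int (c i) * \<alpha> i v) = 0) \<longrightarrow> (\<forall>i\<in>I. c i = 0)) \<and>
     (\<forall>c::'i \<Rightarrow> int. (\<Sum>i\<in>I. of_int (c i) *\<^sub>R \<alpha>v i) = 0 \<longrightarrow> (\<forall>i\<in>I. c i = 0)) \<and>
     (\<forall>i\<in>I. \<forall>j\<in>I. \<alpha> j (\<alpha>v i) = of_int (a i j))"

definition basis_family :: "'i set \<Rightarrow> ('i \<Rightarrow> 'v::euclidean_space) \<Rightarrow> bool" where
  "basis_family I b \<longleftrightarrow> inj_on b I \<and> independent (b ` I) \<and> span (b ` I) = UNIV"

section \<open>Weyl group, Tits cone, vectorial faces\<close>

definition simple_reflection ::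
  "('i \<Rightarrow> 'v::euclidean_space \<Rightarrow> real) \<Rightarrow> ('i \<Rightarrow> 'v) \<Rightarrow> 'i \<Rightarrow> 'v \<Rightarrow> 'v" where
  "simple_reflection \<alpha> \<alpha>v i v = v - \<alpha> i v *\<^sub>R \<alpha>v i"

inductive_set weyl_group ::
  "'i set \<Rightarrow> ('i \<Rightarrow> 'v::euclidean_space \<Rightarrow> real) \<Rightarrow> ('i \<Rightarrow> 'v) \<Rightarrow> ('v \<Rightarrow> 'v) set"
  for I :: "'i set" and \<alpha> :: "'i \<Rightarrow> 'v \<Rightarrow> real" and \<alpha>v :: "'i \<Rightarrow> 'v" where
  one: "id \<in> weyl_group I \<alpha> \<alpha>v"
| gen: "i \<in> I \<Longrightarrow> simple_reflection \<alpha> \<alpha>v i \<in> weyl_group I \<alpha> \<alpha>v"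
| comp: "w \<in> weyl_group I \<alpha> \<alpha>v \<Longrightarrow> w' \<in> weyl_group I \<alpha> \<alpha>v \<Longrightarrow> w \<circ> w' \<in> weyl_group I \<alpha> \<alpha>v"
| inv: "w \<in> weyl_group I \<alpha> \<alpha>v \<Longrightarrow> inv w \<in> weyl_group I \<alpha> \<alpha>v"

definition fundamental_chamber ::
  "'i set \<Rightarrow> ('i \<Rightarrow> 'v::euclidean_space \<Rightarrow> real) \<Rightarrow> 'v set" where
  "fundamental_chamber I \<alpha> = {v. \<forall>i\<in>I. \<alpha> i v > 0}"

definition tits_cone ::
  "'i set \<Rightarrow> ('i \<Rightarrow> 'v::euclidean_space \<Rightarrow> real) \<Rightarrow> ('i \<Rightarrow> 'v) \<Rightarrow> 'v set" where
  "tits_cone I \<alpha> \<alpha>v = (\<Union>w\<in>weyl_group I \<alpha> \<alpha>v. w ` closure (fundamental_chamber I \<alpha>))"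

definition Y_plus ::
  "'i set \<Rightarrow> 'v set \<Rightarrow> ('i \<Rightarrow> 'v::euclidean_space \<Rightarrow> real) \<Rightarrow> ('i \<Rightarrow> 'v) \<Rightarrow> 'v set" where
  "Y_plus I Y \<alpha> \<alpha>v = Y \<inter> tits_cone I \<alpha> \<alpha>v"

definition A_in :: "'i set \<Rightarrow> ('i \<Rightarrow> 'v::euclidean_space \<Rightarrow> real) \<Rightarrow> 'v set" where
  "A_in I \<alpha> = (\<Inter>i\<in>I. {v. \<alpha> i v = 0})"

text \<open>
  Sets of simple reflections are given by the corresponding sets \<open>J\<close> of indices; since the
  families \<open>\<alpha>\<close> and \<open>\<alpha>v\<close> are free, distinct indices give distinct reflections.
\<close>

definition standard_face ::
  "'i set \<Rightarrow> ('i \<Rightarrow> 'v::euclidean_space \<Rightarrow> real) \<Rightarrow> 'i set \<Rightarrow> 'v set" where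
  "standard_face I \<alpha> J = {x. (\<forall>j\<in>J. \<alpha> j x = 0) \<and> (\<forall>j\<in>I - J. \<alpha> j x > 0)}"

definition positive_vectorial_faces ::
  "'i set \<Rightarrow> ('i \<Rightarrow> 'v::euclidean_space \<Rightarrow> real) \<Rightarrow> ('i \<Rightarrow> 'v) \<Rightarrow> 'v set set" where
  "positive_vectorial_faces I \<alpha> \<alpha>v =
     {w ` standard_face I \<alpha> J | w J. w \<in> weyl_group I \<alpha> \<alpha>v \<and> J \<subseteq> I}"

definition spherical ::
  "'i set \<Rightarrow> ('i \<Rightarrow> 'v::euclidean_space \<Rightarrow> real) \<Rightarrow> ('i \<Rightarrow> 'v) \<Rightarrow> 'v set \<Rightarrow> bool" where
  "spherical I \<alpha> \<alpha>v F \<longleftrightarrow> finite {w \<in> weyl_group I \<alpha> \<alpha>v. \<forall>x\<in>F. w x = x}"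

section \<open>Multiplicative maps\<close>

text \<open>
  Maps defined on \<open>M\<close> are represented by functions that are \<open>undefined\<close> outside \<open>M\<close>. As the
  zero map is to be admitted, \<open>\<tau> 0 = 1\<close> is not required.
\<close>

definition hom_mon :: "'v::ab_group_add set \<Rightarrow> 'k::field set \<Rightarrow> ('v \<Rightarrow> 'k) set" where
  "hom_mon M N = {\<tau> \<in> M \<rightarrow>\<^sub>E N. \<forall>l\<in>M. \<forall>m\<in>M. \<tau> (l + m) = \<tau> l * \<tau> m}"

end

theory Submission
  imports Defs
begin

text \<open>
  The indicator function of \<open>A_in\<close> is multiplicative on \<open>Y_plus\<close> because \<open>A_in\<close> is a face of the
  Tits cone: if \<open>w v + w' v'\<close> lies in \<open>A_in\<close> with \<open>v, v'\<close> dominant, then applying \<open>inv w\<close> and using that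
  \<open>inv w (w' v')\<close> is \<open>v'\<close> minus a nonnegative combination \<open>n\<close> of simple coroots, all simple roots are
  nonnegative on \<open>n\<close>. Pairing with a positive vector \<open>u\<close> such that \<open>A u < 0\<close> forces \<open>n = 0\<close>, hence
  \<open>v\<close> lies in \<open>A_in\<close>.

  Both this order property of orbits and the convexity of the Tits cone follow from the fact that a
  simple root composed with a Weyl group element has constant sign on dominant vectors. That in turn
  is obtained from a game on the orbit of a point \<open>\<rho>\<close> of the open chamber: reflecting only where the
  simple root is positive already reaches all of the orbit. The confluence of the game is a
  rank two computation, one case for each value 0, 1, 2, 3, at least 4 of \<open>a i j * a j i\<close>.
\<close>

text \<open>Rewrite rules for simplifying polynomials in two unknown factors of which only the
  product is known; the second factor may be buried one level down in a right-nested
  product.\<close>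

lemma mult_pair_eq:
  fixes x y :: "'a::ab_semigroup_mult"
  assumes "x * y = z"
  shows "x * (y * t) = z * t" and "y * (x * t) = z * t"
  by (simp_all add: ac_simps flip: assms)

section \<open>Simple reflections and the reflection game on the orbit of a base point\<close>

locale kac_moody_reflections =
  fixes I :: "'i set" and a :: "'i \<Rightarrow> 'i \<Rightarrow> int"
    and \<alpha> :: "'i \<Rightarrow> 'v::euclidean_space \<Rightarrow> real" and \<alpha>v :: "'i \<Rightarrow> 'v"
  assumes matrix: "kac_moody_matrix I a"
    and linear_root: "i \<in> I \<Longrightarrow> linear (\<alpha> i)"
    and root_coroot: "i \<in> I \<Longrightarrow> j \<in> I \<Longrightarrow> \<alpha> j (\<alpha>v i) = of_int (a i j)"
begin

abbreviation refl :: "'i \<Rightarrow> 'v \<Rightarrow> 'v" where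
  "refl \<equiv> simple_reflection \<alpha> \<alpha>v"

abbreviation W :: "('v \<Rightarrow> 'v) set" where
  "W \<equiv> weyl_group I \<alpha> \<alpha>v"

abbreviation C :: "'v set" where
  "C \<equiv> fundamental_chamber I \<alpha>"

text \<open>The closure of \<open>C\<close> given by inequalities; \<open>closure_chamber\<close>
  proves the agreement once \<open>C\<close> has a point.\<close>

definition dominant :: "'v set" where
  "dominant = {v. \<forall>i\<in>I. \<alpha> i v \<ge> 0}"

text \<open>The game records the group element rather than the point \<open>w \<rho>\<close>, so
  that reaching every element of \<open>W\<close> can be expressed. The number of moves serves as
  the induction measure later.\<close>

inductive reduced :: "'v \<Rightarrow> nat \<Rightarrow> ('v \<Rightarrow> 'v) \<Rightarrow> bool" for \<rho> :: 'v where
  id: "reduced \<rho> 0 id"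
| step: "reduced \<rho> n w \<Longrightarrow> i \<in> I \<Longrightarrow> \<alpha> i (w \<rho>) > 0 \<Longrightarrow> reduced \<rho> (Suc n) (refl i \<circ> w)"

lemma finite_I: "finite I"
  and diag: "i \<in> I \<Longrightarrow> a i i = 2"
  and off_diag: "i \<in> I \<Longrightarrow> j \<in> I \<Longrightarrow> i \<noteq> j \<Longrightarrow> a i j \<le> 0"
  and zero_sym: "i \<in> I \<Longrightarrow> j \<in> I \<Longrightarrow> a i j = 0 \<longleftrightarrow> a j i = 0"
  using matrix by (simp_all add: kac_moody_matrix_def)

lemma root_refl:
  assumes "i \<in> I" "j \<in> I"
  shows "\<alpha> j (refl i x) = \<alpha> j x - of_int (a i j) * \<alpha> i x"
  using linear_diff[OF linear_root[OF assms(2)]] linear_cmul[OF linear_root[OF assms(2)]]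
    root_coroot[OF assms]
  by (simp add: simple_reflection_def)

lemma root_refl_self: "i \<in> I \<Longrightarrow> \<alpha> i (refl i x) = - \<alpha> i x"
  using root_refl[of i i x] diag[of i] by simp

lemma refl_refl: "i \<in> I \<Longrightarrow> refl i (refl i x) = x"
  unfolding simple_reflection_def[of _ _ _ "refl i x"] root_refl_self
  by (simp add: simple_reflection_def)

lemma refl_comp_refl: "i \<in> I \<Longrightarrow> refl i \<circ> (refl i \<circ> w) = w"
  by (simp add: fun_eq_iff refl_refl)

lemma linear_refl:
  assumes "i \<in> I" shows "linear (refl i)"
  unfolding simple_reflection_def
  by (rule linearI) (simp_all add: linear_add[OF linear_root[OF assms]]
      linear_cmul[OF linear_root[OF assms]] algebra_simps)

lemma reduced_linear: "reduced \<rho> n w \<Longrightarrow> linear w"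
proof (induction rule: reduced.induct)
  case id
  show ?case by (rule linear_id)
next
  case (step n w i)
  show ?case by (rule linear_compose[OF step.IH linear_refl[OF step.hyps(2)]])
qed

lemma reduced_in_weyl: "reduced \<rho> n w \<Longrightarrow> w \<in> W"
  by (induction rule: reduced.induct) (blast intro: weyl_group.intros)+

lemma reduced_up:
  assumes "reduced \<rho> n (refl i \<circ> w)" "i \<in> I" "\<alpha> i (w \<rho>) < 0"
  shows "reduced \<rho> (Suc n) w"
  using reduced.step[OF assms(1,2)] assms(2,3) by (simp add: root_refl_self refl_comp_refl)

text \<open>
  \<open>walk i j m\<close> applies \<open>m\<close> alternating reflections, \<open>refl i\<close> first; \<open>pairing i j m x\<close> is the value, just
  before step \<open>m\<close> (counted from 0), of the simple root about to be reflected.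
\<close>

fun walk :: "'i \<Rightarrow> 'i \<Rightarrow> nat \<Rightarrow> 'v \<Rightarrow> 'v" where
  "walk i j 0 x = x"
| "walk i j (Suc m) x = walk j i m (refl i x)"

fun pairing :: "'i \<Rightarrow> 'i \<Rightarrow> nat \<Rightarrow> 'v \<Rightarrow> real" where
  "pairing i j 0 x = \<alpha> i x"
| "pairing i j (Suc m) x = pairing j i m (refl i x)"

lemma pairing_eq: "pairing i j m x = \<alpha> (if even m then i else j) (walk i j m x)"
  by (induction m arbitrary: i j x) auto

lemma walk_comp_Suc: "walk i j (Suc m) \<circ> w = walk j i m \<circ> (refl i \<circ> w)"
  by (simp add: fun_eq_iff)

lemma reduced_walk_up:
  assumes "i \<in> I" "j \<in> I" "reduced \<rho> n (walk i j m \<circ> w)" "\<And>t. t < m \<Longrightarrow> pairing i j t (w \<rho>) < 0"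
  shows "reduced \<rho> (n + m) w"
  using assms
proof (induction m arbitrary: i j w)
  case 0
  then show ?case by (simp add: fun_eq_iff comp_def)
next
  case (Suc m)
  have "reduced \<rho> (n + m) (refl i \<circ> w)"
    using Suc.prems(1-3) Suc.prems(4)[of "Suc _"] unfolding walk_comp_Suc by (intro Suc.IH) auto
  moreover have "\<alpha> i (w \<rho>) < 0" using Suc.prems(4)[of 0] by simp
  ultimately show ?case using reduced_up Suc.prems(1) by simp
qed

section \<open>Rank two: braid relations in coordinates\<close>

definition plane_point :: "'i \<Rightarrow> 'i \<Rightarrow> 'v \<Rightarrow> real \<Rightarrow> real \<Rightarrow> 'v" where
  "plane_point i j x s t = x + s *\<^sub>R \<alpha>v i + t *\<^sub>R \<alpha>v j"

text \<open>The affine plane through \<open>x\<close> in the directions of two coroots is stable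
  under both reflections, and each changes only one of the coordinates \<open>s\<close>,
  \<open>t\<close>.\<close>

lemma refl_plane_point:
  assumes "i \<in> I" "j \<in> I"
  shows "refl i (plane_point i j x s t)
      = plane_point i j x (- of_int (a j i) * t - s - \<alpha> i x) t"
    and "refl j (plane_point i j x s t)
      = plane_point i j x s (- of_int (a i j) * s - t - \<alpha> j x)"
proof -
  note lin = linear_add[OF linear_root] linear_cmul[OF linear_root]
  have *: "\<alpha> i (plane_point i j x s t) = \<alpha> i x + 2 * s + of_int (a j i) * t"
    "\<alpha> j (plane_point i j x s t) = \<alpha> j x + of_int (a i j) * s + 2 * t"
    using assms by (simp_all add: plane_point_def lin root_coroot diag)
  show "refl i (plane_point i j x s t)
      = plane_point i j x (- of_int (a j i) * t - s - \<alpha> i x) t"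
    and "refl j (plane_point i j x s t)
      = plane_point i j x s (- of_int (a i j) * s - t - \<alpha> j x)"
    unfolding simple_reflection_def * by (simp_all add: plane_point_def algebra_simps flip: scaleR_2)
qed

lemma plane_point_zero: "plane_point i j x 0 0 = x"
  by (simp add: plane_point_def)

text \<open>Both walks start at coordinates (0, 0) of the plane through \<open>x\<close>. The
  resulting coordinates are polynomials in the two off-diagonal entries that agree once the entries,
  or their product, are replaced by the given value.\<close>

lemma braid:
  assumes ij: "i \<in> I" "j \<in> I"
  shows braid2: "a i j = 0 \<Longrightarrow> a j i = 0 \<Longrightarrow> walk j i 2 x = walk i j 2 x"
    and braid3: "a i j = -1 \<Longrightarrow> a j i = -1 \<Longrightarrow> walk j i 3 x = walk i j 3 x"
    and braid4: "a i j * a j i = 2 \<Longrightarrow> walk j i 4 x = walk i j 4 x"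
    and braid6: "a i j * a j i = 3 \<Longrightarrow> walk j i 6 x = walk i j 6 x"
proof -
  have walks:
    "walk i j 2 y = refl j (refl i y)"
    "walk i j 3 y = refl i (refl j (refl i y))"
    "walk i j 4 y = refl j (refl i (refl j (refl i y)))"
    "walk i j 6 y = refl j (refl i (refl j (refl i (refl j (refl i y)))))" for i j y
    by (simp_all add: eval_nat_numeral)
  note red = walks refl_plane_point[OF ij]
  have prod: "real_of_int (a i j) * of_int (a j i) = of_int N" if "a i j * a j i = N" for N
    using that by (simp flip: of_int_mult)
  have "walk j i 2 (plane_point i j x 0 0) = walk i j 2 (plane_point i j x 0 0)"
    if "a i j = 0" "a j i = 0"
    unfolding red using that by (simp add: refl_plane_point[OF ij])
  then show "a i j = 0 \<Longrightarrow> a j i = 0 \<Longrightarrow> walk j i 2 x = walk i j 2 x"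
    unfolding plane_point_zero .
  have "walk j i 3 (plane_point i j x 0 0) = walk i j 3 (plane_point i j x 0 0)"
    if "a i j = -1" "a j i = -1"
    unfolding red using that by (simp add: refl_plane_point[OF ij])
  then show "a i j = -1 \<Longrightarrow> a j i = -1 \<Longrightarrow> walk j i 3 x = walk i j 3 x"
    unfolding plane_point_zero .
  have "walk j i 4 (plane_point i j x 0 0) = walk i j 4 (plane_point i j x 0 0)"
    if N: "a i j * a j i = 2"
    unfolding red by (rule arg_cong2[of _ _ _ _ "plane_point i j x"])
      (simp_all add: ring_distribs mult_pair_eq[OF prod[OF N]])
  then show "a i j * a j i = 2 \<Longrightarrow> walk j i 4 x = walk i j 4 x"
    unfolding plane_point_zero .
  have "walk j i 6 (plane_point i j x 0 0) = walk i j 6 (plane_point i j x 0 0)"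
    if N: "a i j * a j i = 3"
    unfolding red by (rule arg_cong2[of _ _ _ _ "plane_point i j x"])
      (simp_all add: ring_distribs mult_pair_eq[OF prod[OF N]])
  then show "a i j * a j i = 3 \<Longrightarrow> walk j i 6 x = walk i j 6 x"
    unfolding plane_point_zero .
qed

text \<open>Induction on the number of moves. If the last move was at \<open>i\<close>, it is simply
  undone. If it was at \<open>j \<noteq> i\<close>, only the two reflections \<open>refl i\<close>
  and \<open>refl j\<close> matter: either a descent by alternating moves meets the other side of a
  braid relation, or the product of the entries is at least 4 and both roots cannot be
  nonpositive.\<close>

lemma exchange:
  assumes "\<rho> \<in> C" "reduced \<rho> n w" "i \<in> I"
  shows "\<alpha> i (w \<rho>) \<noteq> 0 \<and> (\<alpha> i (w \<rho>) < 0 \<longrightarrow> (\<exists>m. n = Suc m \<and> reduced \<rho> m (refl i \<circ> w)))"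
  using assms(2,3)
proof (induction n arbitrary: w i rule: less_induct)
  case (less n)
  have down: "\<exists>k. m = Suc k \<and> reduced \<rho> k (refl l \<circ> u)"
    if "m < n" "reduced \<rho> m u" "l \<in> I" "\<alpha> l (u \<rho>) < 0" for m u l
    using less.IH[OF that(1-3)] that(4) by blast
  have nz: "\<alpha> l (u \<rho>) \<noteq> 0" if "m < n" "reduced \<rho> m u" "l \<in> I" for m u l
    using less.IH[OF that] by blast
  from less.prems(1) show ?case
  proof (cases rule: reduced.cases)
    case id
    then show ?thesis using assms(1) less.prems(2) by (auto simp: fundamental_chamber_def)
  next
    case (step k w' j)
    have i: "i \<in> I" and j: "j \<in> I" by fact+
    have w': "w' = refl j \<circ> w" using step(2,4) by (simp add: refl_comp_refl)
    have R1: "reduced \<rho> k (refl j \<circ> w)" using step w' by simp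
    show ?thesis
    proof (cases "i = j")
      case True
      have "\<alpha> i (w \<rho>) < 0" using step(2,5) True i by (simp add: root_refl_self)
      moreover have "reduced \<rho> k (refl i \<circ> w)" using R1 unfolding True .
      ultimately show ?thesis using step(1) less_imp_neq by blast
    next
      case False
      \<comment> \<open>The minus signs make \<open>b\<close> and \<open>c\<close> nonnegative. For
        \<open>p > 0\<close> the claim is immediate, so only \<open>p \<le> 0\<close>
        remains.\<close>
      define p q b c where "p = \<alpha> i (w \<rho>)" and "q = \<alpha> j (w \<rho>)"
        and "b = - real_of_int (a j i)" and "c = - real_of_int (a i j)"
      have q: "q < 0" using step j by (simp add: q_def root_refl_self)
      have bc: "b \<ge> 0" "c \<ge> 0" "b = 0 \<longleftrightarrow> c = 0"
        using off_diag[OF i j] off_diag[OF j i] zero_sym[OF i j] False by (auto simp: b_def c_def)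
      have ri: "\<alpha> i (refl i x) = - \<alpha> i x" "\<alpha> j (refl i x) = \<alpha> j x + c * \<alpha> i x"
        and rj: "\<alpha> j (refl j x) = - \<alpha> j x" "\<alpha> i (refl j x) = \<alpha> i x + b * \<alpha> j x" for x
        using root_refl[OF i j] root_refl[OF j i] root_refl_self i j by (simp_all add: b_def c_def)
      note rr = ri rj p_def[symmetric] q_def[symmetric]
      have goal: ?thesis if "p \<le> 0 \<Longrightarrow> p < 0 \<and> reduced \<rho> k (refl i \<circ> w)"
        using that step(1) by (fastforce simp: p_def)
      have kn: "k < n" using step by simp
      show ?thesis
      proof (rule goal)
        assume p: "p \<le> 0"
        \<comment> \<open>Here \<open>Suc m\<close> is the length of the braid relation: 2, 3, 4 or
          6 in the uses below.\<close>
        have finite_case: "p < 0 \<and> reduced \<rho> k (refl i \<circ> w)"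
          if braid: "\<And>x. walk j i (Suc m) x = walk i j (Suc m) x"
            and neg: "\<And>t. t < m \<Longrightarrow> pairing j i t (w \<rho>) < 0" and last: "pairing j i m (w \<rho>) = p"
            and neg': "\<And>t. p < 0 \<Longrightarrow> t < m \<Longrightarrow> pairing i j (Suc t) (w \<rho>) < 0" for m
        proof -
          have descend: "\<exists>k'. h = k' + d \<and> reduced \<rho> k' (walk l l' d \<circ> u)"
            if "h < n" "reduced \<rho> h u" "l \<in> I" "l' \<in> I" "\<And>t. t < d \<Longrightarrow> pairing l l' t (u \<rho>) < 0"
            for h u l l' d
            using that
          proof (induction d arbitrary: h u l l')
            case 0
            then show ?case by (simp add: fun_eq_iff comp_def)
          next
            case (Suc d)
            obtain h' where h': "h = Suc h'" "reduced \<rho> h' (refl l \<circ> u)"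
              using down[OF Suc.prems(1-3)] Suc.prems(5)[of 0] by auto
            have "h' < n" using h'(1) Suc.prems(1) by simp
            moreover have "pairing l' l t ((refl l \<circ> u) \<rho>) < 0" if "t < d" for t
              using Suc.prems(5)[of "Suc t"] that by simp
            ultimately have "\<exists>k'. h' = k' + d \<and> reduced \<rho> k' (walk l' l d \<circ> (refl l \<circ> u))"
              using Suc.IH h'(2) Suc.prems(3,4) by blast
            then show ?case unfolding walk_comp_Suc using h'(1) by (metis add_Suc_right)
          qed
          have "p \<noteq> 0"
          proof (cases m)
            case 0
            then show ?thesis using last q by (simp add: q_def)
          next
            case (Suc m')
            \<comment> \<open>As long as \<open>p = 0\<close> is possible, the walk from
              \<open>w\<close> can be followed down for \<open>m\<close> moves only. The element
              reached has fewer than \<open>n\<close> moves, so by induction the next pairing, which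
              is \<open>p\<close>, is nonzero.\<close>
            have "pairing i j t ((refl j \<circ> w) \<rho>) < 0" if "t < m'" for t
              using neg[of "Suc t"] that Suc by simp
            from descend[OF kn R1 i j this] obtain k'
              where k': "k = k' + m'" "reduced \<rho> k' (walk i j m' \<circ> (refl j \<circ> w))" by blast
            have "k' < n" using k'(1) kn by simp
            from nz[OF this k'(2)] i j have "pairing i j m' ((refl j \<circ> w) \<rho>) \<noteq> 0"
              by (simp add: pairing_eq)
            then show ?thesis using last Suc by simp
          qed
          with p have p0: "p < 0" by simp
          have "pairing i j t ((refl j \<circ> w) \<rho>) < 0" if "t < m" for t
          proof (cases "Suc t = m")
            case True
            then show ?thesis using last p0 by auto
          next
            case False
            then show ?thesis using neg[of "Suc t"] that by simp
          qed
          from descend[OF kn R1 i j this] obtain k'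
            where k': "k = k' + m" "reduced \<rho> k' (walk i j m \<circ> (refl j \<circ> w))" by blast
          \<comment> \<open>By the braid relation the bottom of the descent also ends the walk that
            starts with \<open>refl i\<close>. Climbing back along that walk for \<open>m\<close>
            moves stops one move short of \<open>w\<close>, at
            \<open>refl i \<circ> w\<close>.\<close>
          have "walk i j m \<circ> (refl j \<circ> w) = walk j i m \<circ> (refl i \<circ> w)"
            using braid by (simp add: fun_eq_iff)
          with k'(2) have "reduced \<rho> k' (walk j i m \<circ> (refl i \<circ> w))" by (simp only:)
          moreover have "pairing j i t ((refl i \<circ> w) \<rho>) < 0" if "t < m" for t
            using neg'[OF p0 that] by simp
          ultimately have "reduced \<rho> (k' + m) (refl i \<circ> w)"
            using reduced_walk_up[OF j i] by blast
          with p0 k'(1) show ?thesis by blast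
        qed
        have bcN: "b * c = real_of_int (a i j * a j i)" by (simp add: b_def c_def)
        note eqs = eval_nat_numeral All_less_Suc rr ring_distribs
        consider "b = 0" "c = 0" | "b > 0" "c > 0"
          using bc by fastforce
        then show "p < 0 \<and> reduced \<rho> k (refl i \<circ> w)"
        proof cases
          case 1
          then have "a i j = 0" "a j i = 0" by (simp_all add: b_def c_def)
          then show ?thesis
            using braid2[OF i j] 1 q by (intro finite_case[of 1]) (simp_all add: rr eval_nat_numeral)
        next
          case 2
          have bq: "b * q < 0" using 2 q by (simp add: mult_pos_neg)
          have cp: "c * p \<le> 0" using 2 p by (simp add: mult_nonneg_nonpos)
          have "0 < real_of_int (a i j * a j i)" using 2 unfolding bcN[symmetric] by simp
          then have "a i j * a j i > 0" by linarith
          then consider "a i j * a j i = 1" | "a i j * a j i = 2" | "a i j * a j i = 3" | "a i j * a j i \<ge> 4"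
            by linarith
          then show ?thesis
          proof cases
            case 1
            then have N: "a i j = -1" "a j i = -1"
              using 2 by (auto simp: zmult_eq_1_iff b_def c_def)
            then have "b = 1" "c = 1" by (simp_all add: b_def c_def)
            then have "\<forall>t<2. pairing j i t (w \<rho>) < 0" "pairing j i 2 (w \<rho>) = p"
              "p < 0 \<Longrightarrow> \<forall>t<2. pairing i j (Suc t) (w \<rho>) < 0"
              using p q by (auto simp: eqs)
            then show ?thesis using braid3[OF i j N] by (intro finite_case[of 2]) auto
          next
            case 2
            have "b * c = 2" using bcN 2 by simp
            note M = mult_pair_eq[OF this]
            \<comment> \<open>The pairings are the values at \<open>w \<rho>\<close> of the positive
              roots of the rank two system, here \<open>q\<close>, \<open>p + b * q\<close>,
              \<open>q + c * p\<close>, \<open>p\<close>; the other walk meets them in reverse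
              order.\<close>
            have "\<forall>t<3. pairing j i t (w \<rho>) < 0" "pairing j i 3 (w \<rho>) = p"
              "p < 0 \<Longrightarrow> \<forall>t<3. pairing i j (Suc t) (w \<rho>) < 0"
              using p q bq cp by (auto simp: eqs M)
            then show ?thesis using braid4[OF i j 2] by (intro finite_case[of 3]) auto
          next
            case 3
            have "b * c = 3" using bcN 3 by simp
            note M = mult_pair_eq[OF this]
            have "\<forall>t<5. pairing j i t (w \<rho>) < 0" "pairing j i 5 (w \<rho>) = p"
              "p < 0 \<Longrightarrow> \<forall>t<5. pairing i j (Suc t) (w \<rho>) < 0"
              using p q bq cp by (auto simp: eqs M)
            then show ?thesis using braid6[OF i j 3] by (intro finite_case[of 5]) auto
          next
            case 4
            then have N: "b * c \<ge> 4" unfolding bcN by linarith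
            have M: "4 * t \<ge> c * (b * t)" if "t < 0" for t
              using mult_right_mono_neg[OF N, of t] that by (simp add: mult_ac)
            have M': "4 * t \<ge> b * (c * t)" if "t < 0" for t
              using mult_right_mono_neg[OF N, of t] that by (simp add: mult_ac)
            \<comment> \<open>Both conditions are inherited, with \<open>i\<close> and \<open>j\<close> exchanged, by the next point on the way down
              to \<open>\<rho>\<close>, where neither can hold.\<close>
            have "\<not> (\<alpha> j (u \<rho>) < 0 \<and> 2 * \<alpha> i (u \<rho>) + b * \<alpha> j (u \<rho>) < 0)
                \<and> \<not> (\<alpha> i (u \<rho>) < 0 \<and> 2 * \<alpha> j (u \<rho>) + c * \<alpha> i (u \<rho>) < 0)"
              if "m < n" "reduced \<rho> m u" for m u
              using that
            proof (induction m arbitrary: u rule: less_induct)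
              case (less m)
              define A B where "A = \<alpha> i (u \<rho>)" and "B = \<alpha> j (u \<rho>)"
              have False if AB: "B < 0" "2 * A + b * B < 0"
              proof -
                from down[OF less.prems j] AB obtain m' where m': "m = Suc m'" "reduced \<rho> m' (refl j \<circ> u)"
                  unfolding B_def by blast
                have "b * B < 0" "c * (2 * A + b * B) < 0"
                  using 2 AB by (simp_all add: mult_pos_neg)
                moreover from this(2) have "2 * (c * A) + c * (b * B) < 0"
                  by (simp add: ring_distribs)
                ultimately have "A + b * B < 0" "2 * (- B) + c * (A + b * B) < 0"
                  using AB M[OF AB(1)] unfolding distrib_left by linarith+
                with less.IH[OF _ _ m'(2)] m'(1) less.prems(1) show False
                  by (simp add: rj A_def B_def)
              qed
              moreover have False if AB: "A < 0" "2 * B + c * A < 0"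
              proof -
                from down[OF less.prems i] AB obtain m' where m': "m = Suc m'" "reduced \<rho> m' (refl i \<circ> u)"
                  unfolding A_def by blast
                have "c * A < 0" "b * (2 * B + c * A) < 0"
                  using 2 AB by (simp_all add: mult_pos_neg)
                moreover from this(2) have "2 * (b * B) + b * (c * A) < 0"
                  by (simp add: ring_distribs)
                ultimately have "B + c * A < 0" "2 * (- A) + b * (B + c * A) < 0"
                  using AB M'[OF AB(1)] unfolding distrib_left by linarith+
                with less.IH[OF _ _ m'(2)] m'(1) less.prems(1) show False
                  by (simp add: ri A_def B_def)
              qed
              ultimately show ?case unfolding A_def B_def by blast
            qed
            \<comment> \<open>At the point before the last move the two roots take the values
              \<open>p + b * q\<close> and \<open>-q\<close>, and these satisfy the second excluded
              condition.\<close>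
            from this[OF kn R1] have "\<not> (p + b * q < 0 \<and> 2 * (- q) + c * (p + b * q) < 0)"
              by (simp add: rr)
            moreover have "p + b * q < 0" using p bq by simp
            moreover have "2 * (- q) + c * (p + b * q) < 0"
              using q cp M[OF q] unfolding distrib_left by linarith
            ultimately show "p < 0 \<and> reduced \<rho> k (refl i \<circ> w)" by blast
          qed
        qed
      qed
    qed
  qed
qed

section \<open>From the game to the whole Weyl group: signs of roots on orbits\<close>

lemma weyl_bij: "w \<in> W \<Longrightarrow> bij w"
proof (induction rule: weyl_group.induct)
  case one
  show ?case by (rule bij_id)
next
  case (gen i)
  show ?case by (rule o_bij[of "refl i"]) (use gen in \<open>auto simp: fun_eq_iff refl_refl\<close>)
next
  case (comp w w')
  from comp.IH(2,1) show ?case by (rule bij_comp)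
next
  case (inv w)
  from inv.IH show ?case by (rule bij_imp_bij_inv)
qed

text \<open>By \<open>exchange\<close> a simple reflection is always a move up or the undoing of a
  move, so the elements reached are closed under left multiplication by simple reflections.\<close>

lemma weyl_reduced:
  assumes "\<rho> \<in> C" "w \<in> W"
  obtains n where "reduced \<rho> n w"
proof -
  let ?R = "\<lambda>w. \<exists>n. reduced \<rho> n w"
  have refl_closed: "?R (refl i \<circ> w)" if R: "?R w" and i: "i \<in> I" for i w
  proof -
    from R obtain n where n: "reduced \<rho> n w" by blast
    from exchange[OF assms(1) n i] consider "\<alpha> i (w \<rho>) > 0" | "?R (refl i \<circ> w)"
      by force
    then show ?thesis using reduced.step[OF n i] by cases blast+
  qed
  \<comment> \<open>An equivalence, and for all \<open>u\<close>, so that the induction passes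
    through inverses and compositions.\<close>
  have "\<forall>u. ?R u \<longleftrightarrow> ?R (w \<circ> u)"
    using assms(2)
  proof (induction rule: weyl_group.induct)
    case one
    show ?case unfolding id_comp by blast
  next
    case (gen i)
    show ?case
      using refl_closed[OF _ gen] refl_comp_refl[OF gen] by metis
  next
    case (comp w w')
    show ?case using comp.IH unfolding comp_assoc by blast
  next
    case (inv w)
    have "w \<circ> (inv w \<circ> u) = u" for u
      using weyl_bij[OF inv.hyps] by (auto simp: fun_eq_iff bij_is_surj surj_f_inv_f)
    with inv.IH show ?case by metis
  qed
  then have "?R (w \<circ> id)" using reduced.id by blast
  with that show thesis unfolding comp_id by blast
qed

lemma weyl_linear: "\<rho> \<in> C \<Longrightarrow> w \<in> W \<Longrightarrow> linear w"
  using weyl_reduced reduced_linear by metis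

text \<open>Otherwise the root composed with \<open>w\<close> would vanish at some
  \<open>v + t *\<^sub>R \<rho>\<close> with \<open>t > 0\<close>. This is a point of the open
  chamber, and \<open>exchange\<close> with it as base point forbids the zero.\<close>

lemma root_weyl_nonneg:
  assumes \<rho>: "\<rho> \<in> C" and w: "w \<in> W" and i: "i \<in> I" and v: "v \<in> dominant"
    and pos: "\<alpha> i (w \<rho>) > 0"
  shows "\<alpha> i (w v) \<ge> 0"
proof (rule ccontr)
  assume neg: "\<not> \<alpha> i (w v) \<ge> 0"
  define t where "t = - \<alpha> i (w v) / \<alpha> i (w \<rho>)"
  have t: "t > 0" using neg pos by (simp add: t_def divide_neg_pos)
  have "v + t *\<^sub>R \<rho> \<in> C"
    using v \<rho> t
    by (auto simp: dominant_def fundamental_chamber_def linear_add[OF linear_root]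
        linear_cmul[OF linear_root] intro!: add_nonneg_pos)
  moreover from this obtain n where "reduced (v + t *\<^sub>R \<rho>) n w" using weyl_reduced w by metis
  ultimately have "\<alpha> i (w (v + t *\<^sub>R \<rho>)) \<noteq> 0" using exchange i by blast
  moreover have "\<alpha> i (w (v + t *\<^sub>R \<rho>)) = 0"
    using pos unfolding linear_add[OF weyl_linear[OF \<rho> w]] linear_cmul[OF weyl_linear[OF \<rho> w]]
      linear_add[OF linear_root[OF i]] linear_cmul[OF linear_root[OF i]] by (simp add: t_def)
  ultimately show False by simp
qed

lemma root_weyl_sign:
  assumes \<rho>: "\<rho> \<in> C" and w: "w \<in> W" and i: "i \<in> I" and v: "v \<in> dominant"
    and neg: "\<alpha> i (w v) < 0"
  shows "\<alpha> i (w \<rho>) < 0"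
proof -
  obtain n where "reduced \<rho> n w" using weyl_reduced[OF \<rho> w] .
  then have "\<alpha> i (w \<rho>) \<noteq> 0" using exchange \<rho> i by blast
  moreover have "\<not> \<alpha> i (w \<rho>) > 0" using root_weyl_nonneg[OF \<rho> w i v] neg by auto
  ultimately show ?thesis by simp
qed

text \<open>Each move of the game for \<open>\<rho>\<close>, carried out on \<open>v\<close>,
  subtracts a multiple of a simple coroot, and \<open>root_weyl_nonneg\<close> makes the multiple
  nonnegative.\<close>

lemma weyl_dominant_below:
  assumes \<rho>: "\<rho> \<in> C" and v: "v \<in> dominant" and w: "w \<in> W"
  obtains c where "\<And>i. i \<in> I \<Longrightarrow> 0 \<le> c i" "w v = v - (\<Sum>i\<in>I. c i *\<^sub>R \<alpha>v i)"
proof -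
  obtain n where "reduced \<rho> n w" using weyl_reduced[OF \<rho> w] .
  then have "\<exists>c. (\<forall>i\<in>I. 0 \<le> c i) \<and> w v = v - (\<Sum>i\<in>I. c i *\<^sub>R \<alpha>v i)"
  proof (induction rule: reduced.induct)
    case id
    show ?case by (intro exI[of _ "\<lambda>_. 0"]) simp
  next
    case (step n w j)
    from step.IH obtain c where c: "\<forall>i\<in>I. 0 \<le> c i" "w v = v - (\<Sum>i\<in>I. c i *\<^sub>R \<alpha>v i)"
      by blast
    have nonneg: "\<alpha> j (w v) \<ge> 0"
      using root_weyl_nonneg[OF \<rho> reduced_in_weyl[OF step.hyps(1)] step.hyps(2) v step.hyps(3)] .
    let ?d = "\<lambda>i. c i + (if i = j then \<alpha> j (w v) else 0)"
    have "(\<Sum>i\<in>I. ?d i *\<^sub>R \<alpha>v i)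
        = (\<Sum>i\<in>I. c i *\<^sub>R \<alpha>v i) + (\<Sum>i\<in>I. if i = j then \<alpha> j (w v) *\<^sub>R \<alpha>v i else 0)"
      unfolding sum.distrib[symmetric] by (rule sum.cong) (auto simp: scaleR_left_distrib)
    also have "(\<Sum>i\<in>I. if i = j then \<alpha> j (w v) *\<^sub>R \<alpha>v i else 0) = \<alpha> j (w v) *\<^sub>R \<alpha>v j"
      using step.hyps(2) by (simp add: finite_I)
    finally have "(refl j \<circ> w) v = v - (\<Sum>i\<in>I. ?d i *\<^sub>R \<alpha>v i)"
      by (simp add: simple_reflection_def c(2))
    then show ?case using c(1) nonneg by (intro exI[of _ ?d]) auto
  qed
  with that show thesis by blast
qed

lemma weyl_fixes_A_in:
  assumes "\<rho> \<in> C" "w \<in> W" "x \<in> A_in I \<alpha>"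
  shows "w x = x"
proof -
  obtain n where "reduced \<rho> n w" using weyl_reduced assms by metis
  then show ?thesis
    by (induction rule: reduced.induct) (use assms(3) in \<open>auto simp: A_in_def simple_reflection_def\<close>)
qed

section \<open>The Tits cone and its stability under addition\<close>

lemma closure_chamber:
  assumes \<rho>: "\<rho> \<in> C"
  shows "closure C = dominant"
proof
  have "continuous_on UNIV (\<alpha> i)" if "i \<in> I" for i
    using linear_continuous_on linear_root[OF that] linear_conv_bounded_linear by blast
  then have "closed {v. 0 \<le> \<alpha> i v}" if "i \<in> I" for i
    using that by (intro closed_Collect_le) auto
  then have "closed (\<Inter>i\<in>I. {v. 0 \<le> \<alpha> i v})" by blast
  also have "(\<Inter>i\<in>I. {v. 0 \<le> \<alpha> i v}) = dominant" by (auto simp: dominant_def)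
  finally show "closure C \<subseteq> dominant"
    by (intro closure_minimal) (auto simp: fundamental_chamber_def dominant_def less_imp_le)
next
  show "dominant \<subseteq> closure C"
  proof
    fix v assume v: "v \<in> dominant"
    \<comment> \<open>Adding any positive multiple of \<open>\<rho>\<close> moves a dominant vector
      into the open chamber.\<close>
    have "(\<lambda>n. v + inverse (real (Suc n)) *\<^sub>R \<rho>) \<longlonglongrightarrow> v + 0 *\<^sub>R \<rho>"
      by (intro tendsto_intros LIMSEQ_inverse_real_of_nat)
    moreover have "v + inverse (real (Suc n)) *\<^sub>R \<rho> \<in> C" for n
      using v \<rho> by (auto simp: dominant_def fundamental_chamber_def linear_add[OF linear_root]
        linear_cmul[OF linear_root] intro!: add_nonneg_pos mult_pos_pos)
    ultimately show "v \<in> closure C" unfolding closure_sequential by (auto intro!: exI)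
  qed
qed

lemma in_tits_cone:
  assumes "\<rho> \<in> C"
  shows "x \<in> tits_cone I \<alpha> \<alpha>v \<longleftrightarrow> (\<exists>w\<in>W. \<exists>v\<in>dominant. x = w v)"
  using closure_chamber[OF assms] by (auto simp: tits_cone_def)

lemma weyl_tits_cone:
  assumes "\<rho> \<in> C" "w \<in> W" "x \<in> tits_cone I \<alpha> \<alpha>v"
  shows "w x \<in> tits_cone I \<alpha> \<alpha>v"
proof -
  from assms(3) obtain w' v where "w' \<in> W" "v \<in> dominant" "x = w' v"
    unfolding in_tits_cone[OF assms(1)] by blast
  with weyl_group.comp[OF assms(2)] have "w \<circ> w' \<in> W" "w x = (w \<circ> w') v" by simp_all
  with \<open>v \<in> dominant\<close> show ?thesis unfolding in_tits_cone[OF assms(1)] by blast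
qed

text \<open>
  The segment from \<open>v\<close> to \<open>w v'\<close> leaves the dominant cone through a wall at a point \<open>z\<close>; reflecting the
  remaining part in that wall fixes \<open>z\<close> and shortens \<open>w\<close>.
\<close>

lemma dominant_add_weyl_dominant:
  assumes \<rho>: "\<rho> \<in> C"
  shows "reduced \<rho> n w \<Longrightarrow> v \<in> dominant \<Longrightarrow> v' \<in> dominant \<Longrightarrow> v + w v' \<in> tits_cone I \<alpha> \<alpha>v"
proof (induction n arbitrary: w v v' rule: less_induct)
  case (less n)
  note lin = linear_add[OF linear_root] linear_cmul[OF linear_root]
  have wW: "w \<in> W" using reduced_in_weyl less.prems(1) .
  define y where "y = w v'"
  show ?case
  proof (cases "v + y \<in> dominant")
    case True
    then show ?thesis
      unfolding in_tits_cone[OF \<rho>] y_def using weyl_group.one by (metis id_apply)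
  next
    case False
    then obtain i0 where i0: "i0 \<in> I" "\<alpha> i0 v + \<alpha> i0 y < 0"
      by (auto simp: dominant_def lin not_le)
    let ?J = "{i\<in>I. \<alpha> i y < 0}"
    \<comment> \<open>The parameter at which the root \<open>i\<close> vanishes on the ray
      \<open>v + t *\<^sub>R y\<close>; the least one over \<open>?J\<close> marks the exit from the
      dominant cone, and \<open>i0\<close> shows that it is below 1.\<close>
    let ?t = "\<lambda>i. \<alpha> i v / - \<alpha> i y"
    have v: "\<alpha> i v \<ge> 0" if "i \<in> I" for i using less.prems(2) that by (simp add: dominant_def)
    have i0J: "i0 \<in> ?J" using i0 v[of i0] by auto
    have "finite (?t ` ?J)" "?t ` ?J \<noteq> {}" using finite_I i0J by auto
    then obtain i where i: "i \<in> ?J" and "?t i = Min (?t ` ?J)"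
      using Min_in by (metis (no_types, lifting) imageE)
    then have min: "?t i \<le> ?t j" if "j \<in> ?J" for j
      using that finite_I by simp
    define s where "s = ?t i"
    have iI: "i \<in> I" and iy: "\<alpha> i y < 0" using i by auto
    have s0: "s \<ge> 0" using v[OF iI] iy unfolding s_def by (intro divide_nonneg_pos) auto
    have "s \<le> ?t i0" using min[OF i0J] by (simp add: s_def)
    also have "\<dots> < 1" using i0(2) i0J by (simp add: divide_simps)
    finally have s1: "s < 1" .
    define z where "z = v + s *\<^sub>R y"
    have zi: "\<alpha> i z = 0" using iy unfolding z_def lin[OF iI] by (simp add: s_def)
    have "z \<in> dominant"
      unfolding dominant_def
    proof (intro CollectI ballI)
      fix j assume j: "j \<in> I"
      show "0 \<le> \<alpha> j z"
      proof (cases "\<alpha> j y < 0")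
        case True
        with min[of j] j have "s \<le> ?t j" by (simp add: s_def)
        with True show ?thesis using j by (simp add: z_def lin field_simps)
      next
        case False
        then show ?thesis using j v[OF j] s0 by (simp add: z_def lin)
      qed
    qed
    moreover have "(1 - s) *\<^sub>R v' \<in> dominant"
      using less.prems(3) s1 by (auto simp: dominant_def lin)
    moreover obtain m where "m < n" "reduced \<rho> m (refl i \<circ> w)"
      using exchange[OF \<rho> less.prems(1) iI] root_weyl_sign[OF \<rho> wW iI less.prems(3)] iy
      unfolding y_def by blast
    ultimately have "z + (refl i \<circ> w) ((1 - s) *\<^sub>R v') \<in> tits_cone I \<alpha> \<alpha>v"
      using less.IH[of m "refl i \<circ> w" z "(1 - s) *\<^sub>R v'"] by blast
    then have "refl i (z + (refl i \<circ> w) ((1 - s) *\<^sub>R v')) \<in> tits_cone I \<alpha> \<alpha>v"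
      by (rule weyl_tits_cone[OF \<rho> weyl_group.gen[OF iI]])
    moreover have "refl i z = z" using zi by (simp add: simple_reflection_def)
    moreover have "w ((1 - s) *\<^sub>R v') = (1 - s) *\<^sub>R y"
      using linear_cmul[OF reduced_linear[OF less.prems(1)]] by (simp add: y_def)
    ultimately have "z + (1 - s) *\<^sub>R y \<in> tits_cone I \<alpha> \<alpha>v"
      using linear_add[OF linear_refl[OF iI]] by (simp add: refl_refl[OF iI])
    also have "z + (1 - s) *\<^sub>R y = v + w v'" by (simp add: z_def y_def algebra_simps)
    finally show ?thesis .
  qed
qed

text \<open>Applying \<open>inv w\<close> makes the first summand dominant and keeps the second in
  the cone, which is the case already settled.\<close>

lemma tits_cone_add:
  assumes \<rho>: "\<rho> \<in> C" and "x \<in> tits_cone I \<alpha> \<alpha>v" "y \<in> tits_cone I \<alpha> \<alpha>v"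
  shows "x + y \<in> tits_cone I \<alpha> \<alpha>v"
proof -
  from assms(2) obtain w v where w: "w \<in> W" "v \<in> dominant" "x = w v"
    unfolding in_tits_cone[OF \<rho>] by blast
  have "inv w y \<in> tits_cone I \<alpha> \<alpha>v"
    using weyl_tits_cone[OF \<rho> weyl_group.inv[OF w(1)] assms(3)] .
  then obtain w' v' where w': "w' \<in> W" "v' \<in> dominant" "inv w y = w' v'"
    unfolding in_tits_cone[OF \<rho>] by blast
  obtain n where "reduced \<rho> n w'" using weyl_reduced[OF \<rho> w'(1)] .
  then have "w (v + w' v') \<in> tits_cone I \<alpha> \<alpha>v"
    using weyl_tits_cone[OF \<rho> w(1) dominant_add_weyl_dominant[OF \<rho> _ w(2) w'(2)]] by blast
  moreover have "w (w' v') = y"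
    using weyl_bij[OF w(1)] by (simp flip: w'(3) add: bij_is_surj surj_f_inv_f)
  ultimately show ?thesis
    using linear_add[OF weyl_linear[OF \<rho> w(1)]] w(3) by simp
qed

section \<open>The face property of \<open>A_in\<close>\<close>

lemma A_in_face_of_tits_cone:
  assumes \<rho>: "\<rho> \<in> C"
    and u: "\<And>i. i \<in> I \<Longrightarrow> u i > 0" "\<And>i. i \<in> I \<Longrightarrow> mat_vec I a u i < 0"
    and "x \<in> tits_cone I \<alpha> \<alpha>v" "y \<in> tits_cone I \<alpha> \<alpha>v" and sum: "x + y \<in> A_in I \<alpha>"
  shows "x \<in> A_in I \<alpha>"
proof -
  note lin = linear_add[OF linear_root] linear_diff[OF linear_root] linear_cmul[OF linear_root]
    linear_sum[OF linear_root]
  from assms(4) obtain w v where w: "w \<in> W" "v \<in> dominant" "x = w v"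
    unfolding in_tits_cone[OF \<rho>] by blast
  from assms(5) obtain w' v' where w': "w' \<in> W" "v' \<in> dominant" "y = w' v'"
    unfolding in_tits_cone[OF \<rho>] by blast
  have iw: "inv w \<in> W" using w(1) by (rule weyl_group.inv)
  obtain c where c: "\<And>i. i \<in> I \<Longrightarrow> 0 \<le> c i"
      "(inv w \<circ> w') v' = v' - (\<Sum>i\<in>I. c i *\<^sub>R \<alpha>v i)"
    using weyl_dominant_below[OF \<rho> w'(2) weyl_group.comp[OF iw w'(1)]] by blast
  \<comment> \<open>The sum is fixed because it lies in \<open>A_in\<close>, while \<open>x\<close>
    is carried back to the dominant \<open>v\<close>.\<close>
  have "x + y = inv w (x + y)" using weyl_fixes_A_in[OF \<rho> iw sum] by simp
  also have "\<dots> = inv w (w v) + inv w (w' v')"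
    using w(3) w'(3) by (simp add: linear_add[OF weyl_linear[OF \<rho> iw]])
  also have "inv w (w v) = v" using weyl_bij[OF w(1)] by (simp add: bij_is_inj)
  also have "v + inv w (w' v') = v + v' - (\<Sum>i\<in>I. c i *\<^sub>R \<alpha>v i)" using c(2) by simp
  finally have xy: "x + y = v + v' - (\<Sum>i\<in>I. c i *\<^sub>R \<alpha>v i)" .
  have rows: "(\<Sum>i\<in>I. c i * of_int (a i j)) = \<alpha> j v + \<alpha> j v'" if j: "j \<in> I" for j
  proof -
    have "\<alpha> j (x + y) = 0" using sum j by (simp add: A_in_def)
    then show ?thesis unfolding xy using j by (simp add: lin root_coroot)
  qed
  \<comment> \<open>The terms on the left are nonpositive and those on the right nonnegative, so all
    vanish; strict negativity of \<open>mat_vec I a u i\<close> then gives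
    \<open>c i = 0\<close>.\<close>
  have "(\<Sum>i\<in>I. c i * mat_vec I a u i) = (\<Sum>j\<in>I. u j * (\<Sum>i\<in>I. c i * of_int (a i j)))"
    unfolding mat_vec_def sum_distrib_left by (subst sum.swap) (simp add: mult_ac)
  also have "\<dots> \<ge> 0"
  proof (rule sum_nonneg)
    fix j assume j: "j \<in> I"
    show "0 \<le> u j * (\<Sum>i\<in>I. c i * of_int (a i j))"
      unfolding rows[OF j] using w(2) w'(2) u(1)[OF j] j by (auto simp: dominant_def)
  qed
  finally have ge: "(\<Sum>i\<in>I. c i * mat_vec I a u i) \<ge> 0" .
  have le: "c i * mat_vec I a u i \<le> 0" if "i \<in> I" for i
    using c(1)[OF that] u(2)[OF that] by (simp add: mult_nonneg_nonpos)
  have "(\<Sum>i\<in>I. - (c i * mat_vec I a u i)) = 0"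
    using ge sum_nonpos[of I "\<lambda>i. c i * mat_vec I a u i"] le by (simp add: sum_negf)
  then have "c i = 0" if "i \<in> I" for i
    using that le u(2)[OF that] finite_I by (subst (asm) sum_nonneg_eq_0_iff) fastforce+
  then have "\<alpha> j v + \<alpha> j v' = 0" if "j \<in> I" for j
    using rows[OF that] by simp
  then have "v \<in> A_in I \<alpha>"
    using w(2) w'(2) by (fastforce simp: A_in_def dominant_def add_nonneg_eq_0_iff)
  then show ?thesis using weyl_fixes_A_in[OF \<rho> w(1)] w(3) by simp
qed

end

section \<open>Lattice points in the open chamber: a theorem of the alternative and rounding\<close>

lemma gordan:
  fixes f :: "'i \<Rightarrow> 'v::euclidean_space \<Rightarrow> real"
  assumes fin: "finite I" and lin: "\<And>i. i \<in> I \<Longrightarrow> linear (f i)"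
    and indep: "\<And>c. \<lbrakk>\<And>i. i \<in> I \<Longrightarrow> 0 \<le> c i; \<And>v. (\<Sum>i\<in>I. c i * f i v) = 0\<rbrakk> \<Longrightarrow> \<forall>i\<in>I. c i = 0"
  shows "\<exists>v. \<forall>i\<in>I. f i v > 0"
proof -
  \<comment> \<open>The vector representing \<open>f i\<close> by the inner product. Were 0 in the
    convex hull of these vectors, the weights would form a nonnegative relation excluded by
    \<open>indep\<close>.\<close>
  define g where "g i = (\<Sum>b\<in>Basis. f i b *\<^sub>R b)" for i
  have f: "f i v = g i \<bullet> v" if "i \<in> I" for i v
  proof -
    have "f i v = f i (\<Sum>b\<in>Basis. (v \<bullet> b) *\<^sub>R b)" by (simp add: euclidean_representation)
    also have "\<dots> = (\<Sum>b\<in>Basis. (v \<bullet> b) * f i b)"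
      using lin[OF that] by (simp add: linear_sum linear_cmul)
    finally show ?thesis
      by (simp add: g_def inner_sum_left inner_commute[of v] mult.commute)
  qed
  have "0 \<notin> convex hull (g ` I)"
  proof
    assume "0 \<in> convex hull (g ` I)"
    then obtain u where u: "\<forall>x\<in>g ` I. 0 \<le> u x" "sum u (g ` I) = 1" "(\<Sum>x\<in>g ` I. u x *\<^sub>R x) = 0"
      using convex_hull_finite[of "g ` I"] fin by auto
    let ?F = "\<lambda>x. {i \<in> I. g i = x}"
    define c where "c i = u (g i) / card (?F (g i))" for i
    have card: "card (?F (g i)) > 0" if "i \<in> I" for i using that fin by (auto simp: card_gt_0_iff)
    have "(\<Sum>i\<in>I. c i * f i v) = 0" for v
    proof -
      have "(\<Sum>i\<in>I. c i * f i v) = (\<Sum>x\<in>g ` I. \<Sum>i\<in>?F x. c i * f i v)"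
        using fin by (rule sum.image_gen)
      also have "\<dots> = (\<Sum>x\<in>g ` I. u x * (x \<bullet> v))"
      proof (rule sum.cong[OF refl])
        fix x assume x: "x \<in> g ` I"
        have "(\<Sum>i\<in>?F x. c i * f i v) = (\<Sum>i\<in>?F x. u x / card (?F x) * (x \<bullet> v))"
          by (rule sum.cong) (auto simp: c_def f)
        also have "\<dots> = u x * (x \<bullet> v)" using x card by (force dest: less_imp_neq)
        finally show "(\<Sum>i\<in>?F x. c i * f i v) = u x * (x \<bullet> v)" .
      qed
      also have "\<dots> = (\<Sum>x\<in>g ` I. u x *\<^sub>R x) \<bullet> v" by (simp add: inner_sum_left)
      finally show ?thesis using u(3) by simp
    qed
    moreover have "0 \<le> c i" if "i \<in> I" for i using that u(1) by (simp add: c_def)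
    ultimately have "\<forall>i\<in>I. c i = 0" by (rule indep[rotated])
    then have "\<forall>x\<in>g ` I. u x = 0" using card by (force simp: c_def)
    with u(2) show False by simp
  qed
  \<comment> \<open>The normal of a hyperplane strictly separating 0 from the hull is the vector
    sought.\<close>
  then obtain v b where "0 < b" "\<forall>x\<in>convex hull (g ` I). v \<bullet> x > b"
    using separating_hyperplane_closed_0[OF convex_convex_hull]
      compact_imp_closed[OF compact_convex_hull[OF finite_imp_compact]] fin
    by (metis finite_imageI)
  then have "f i v > 0" if "i \<in> I" for i
    using that hull_inc[of "g i" "g ` I"] by (force simp: f inner_commute)
  then show ?thesis by blast
qed

lemma full_lattice_add: "full_lattice Y \<Longrightarrow> x \<in> Y \<Longrightarrow> y \<in> Y \<Longrightarrow> x + y \<in> Y"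
  unfolding full_lattice_def
proof (elim exE conjE)
  fix B assume "Y = range (\<lambda>c. \<Sum>b\<in>B. of_int (c b) *\<^sub>R b)" "x \<in> Y" "y \<in> Y"
  then obtain c d where "x = (\<Sum>b\<in>B. of_int (c b) *\<^sub>R b)" "y = (\<Sum>b\<in>B. of_int (d b) *\<^sub>R b)"
    by blast
  then have "x + y = (\<Sum>b\<in>B. of_int (c b + d b) *\<^sub>R b)"
    by (simp add: scaleR_left_distrib sum.distrib)
  then show "x + y \<in> Y"
    unfolding \<open>Y = _\<close> by (intro image_eqI[of _ _ "\<lambda>b. c b + d b"]) auto
qed

lemma full_lattice_zero: "full_lattice Y \<Longrightarrow> 0 \<in> Y"
  by (auto simp: full_lattice_def intro!: image_eqI[of _ _ "\<lambda>_. 0"])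

text \<open>Rounding down the coordinates of \<open>N\<close> times \<open>v\<close> changes
  \<open>f i\<close> by at most \<open>M i\<close>, a bound independent of \<open>N\<close>, so a
  large \<open>N\<close> preserves positivity.\<close>

lemma full_lattice_meets_open_cone:
  fixes f :: "'i \<Rightarrow> 'v::euclidean_space \<Rightarrow> real"
  assumes Y: "full_lattice Y" and fin: "finite I" and lin: "\<And>i. i \<in> I \<Longrightarrow> linear (f i)"
    and v: "\<And>i. i \<in> I \<Longrightarrow> f i v > 0"
  shows "\<exists>y\<in>Y. \<forall>i\<in>I. f i y > 0"
proof -
  from Y obtain B where B: "independent B" "span B = UNIV"
    "Y = range (\<lambda>c. \<Sum>b\<in>B. of_int (c b) *\<^sub>R b)" unfolding full_lattice_def by blast
  have finB: "finite B" using B(1) by (rule independent_imp_finite)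
  from B(2) obtain r where r: "v = (\<Sum>b\<in>B. r b *\<^sub>R b)"
    using span_finite[OF finB] by blast
  define M where "M i = (\<Sum>b\<in>B. \<bar>f i b\<bar>)" for i
  have "\<forall>\<^sub>F N in sequentially. \<forall>i\<in>I. real N * f i v > M i"
  proof (rule eventually_ball_finite[OF fin], rule ballI)
    fix i assume "i \<in> I"
    then have "filterlim (\<lambda>N. real N * f i v) at_top sequentially"
      by (intro filterlim_at_top_mult_tendsto_pos[OF tendsto_const v] filterlim_real_sequentially)
    then show "\<forall>\<^sub>F N in sequentially. real N * f i v > M i"
      by (simp add: filterlim_at_top_dense)
  qed
  then obtain N :: nat where N: "\<And>i. i \<in> I \<Longrightarrow> real N * f i v > M i"
    by (auto simp: eventually_sequentially)
  define y where "y = (\<Sum>b\<in>B. of_int \<lfloor>N * r b\<rfloor> *\<^sub>R b)"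
  have "f i y > 0" if i: "i \<in> I" for i
  proof -
    have "real N * f i v - f i y = (\<Sum>b\<in>B. (N * r b - of_int \<lfloor>N * r b\<rfloor>) * f i b)"
      unfolding y_def r using lin[OF i]
      by (simp add: linear_sum linear_cmul sum_distrib_left left_diff_distrib sum_subtractf mult.assoc)
    also have "\<dots> \<le> M i"
      unfolding M_def
    proof (rule sum_mono)
      fix b
      have "\<bar>N * r b - of_int \<lfloor>N * r b\<rfloor>\<bar> \<le> 1" by linarith
      then have "\<bar>(N * r b - of_int \<lfloor>N * r b\<rfloor>) * f i b\<bar> \<le> \<bar>f i b\<bar>"
        unfolding abs_mult by (rule mult_left_le_one_le[rotated 2]) auto
      then show "(N * r b - of_int \<lfloor>N * r b\<rfloor>) * f i b \<le> \<bar>f i b\<bar>" by linarith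
    qed
    finally show ?thesis using N[OF i] by linarith
  qed
  moreover have "y \<in> Y" unfolding B(3) y_def by (rule range_eqI[OF refl])
  ultimately show ?thesis by blast
qed

section \<open>The indicator function of \<open>A_in\<close> as an additional multiplicative
  map\<close>

theorem lemma6p24:
  fixes I :: "'i set" and a :: "'i \<Rightarrow> 'i \<Rightarrow> int"
    and X :: "('v::euclidean_space \<Rightarrow> real) set" and Y :: "'v set"
    and \<alpha> :: "'i \<Rightarrow> 'v \<Rightarrow> real" and \<alpha>v :: "'i \<Rightarrow> 'v"
  assumes "root_generating_system I a X Y \<alpha> \<alpha>v"
    and "indefinite_type I a"
    and "card I = 3"
    and "\<exists>F \<in> positive_vectorial_faces I \<alpha> \<alpha>v. \<not> spherical I \<alpha> \<alpha>v F \<and> F \<noteq> A_in I \<alpha>"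
    and "basis_family I \<alpha>v"
  shows "hom_mon (Y_plus I Y \<alpha> \<alpha>v) (UNIV :: 'k::field_char_0 set) \<supset>
           hom_mon (Y_plus I Y \<alpha> \<alpha>v) (UNIV - {0}) \<union> {\<lambda>y\<in>Y_plus I Y \<alpha> \<alpha>v. 0}"
proof -
  have km: "kac_moody_matrix I a" and Y: "full_lattice Y"
    and lin: "\<And>i. i \<in> I \<Longrightarrow> linear (\<alpha> i)"
    and rc: "\<And>i j. i \<in> I \<Longrightarrow> j \<in> I \<Longrightarrow> \<alpha> j (\<alpha>v i) = of_int (a i j)"
    using assms(1) by (auto simp: root_generating_system_def dual_lattice_def)
  interpret kac_moody_reflections I a \<alpha> \<alpha>v
    by (rule kac_moody_reflections.intro) (fact km lin rc)+
  obtain u where u: "\<And>i. i \<in> I \<Longrightarrow> u i > 0" "\<And>i. i \<in> I \<Longrightarrow> mat_vec I a u i < 0"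
    using assms(2) unfolding indefinite_type_def by blast
  have indep: "\<forall>i\<in>I. c i = 0"
    if "\<And>i. i \<in> I \<Longrightarrow> 0 \<le> c i" "\<And>v. (\<Sum>i\<in>I. c i * \<alpha> i v) = 0" for c
  proof -
    \<comment> \<open>Evaluating the relation at the coroots puts \<open>c\<close> in the kernel of
      the matrix, where indefinite type admits no nonzero nonnegative vector.\<close>
    have "mat_vec I a c i = 0" if "i \<in> I" for i
      using \<open>(\<Sum>j\<in>I. c j * \<alpha> j (\<alpha>v i)) = 0\<close> that by (simp add: mat_vec_def rc mult.commute)
    with that(1) show ?thesis using assms(2) unfolding indefinite_type_def by auto
  qed
  have "\<exists>v. \<forall>i\<in>I. \<alpha> i v > 0"
    by (rule gordan[OF finite_I lin indep])
  then obtain v where v: "\<And>i. i \<in> I \<Longrightarrow> \<alpha> i v > 0" by blast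
  have "\<exists>z\<in>Y. \<forall>i\<in>I. \<alpha> i z > 0"
    by (rule full_lattice_meets_open_cone[OF Y finite_I lin v])
  then obtain z where z: "z \<in> Y" "\<And>i. i \<in> I \<Longrightarrow> \<alpha> i z > 0" by blast
  then have zC: "z \<in> C" by (simp add: fundamental_chamber_def)
  let ?M = "Y_plus I Y \<alpha> \<alpha>v"
  let ?\<tau> = "\<lambda>y\<in>?M. if y \<in> A_in I \<alpha> then 1 else 0 :: 'k"
  have dom: "v \<in> tits_cone I \<alpha> \<alpha>v" if "v \<in> dominant" for v
    unfolding in_tits_cone[OF zC] using weyl_group.one that by (metis id_apply)
  \<comment> \<open>Two test points: \<open>?\<tau>\<close> is 0 at \<open>z\<close>, so its values
    are not all invertible, and 1 at the origin, so it is not the zero map.\<close>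
  have z_M: "z \<in> ?M" using z dom[of z] by (auto simp: Y_plus_def dominant_def less_imp_le)
  have zero_M: "0 \<in> ?M"
    using full_lattice_zero[OF Y] dom[of 0] lin
    by (auto simp: Y_plus_def dominant_def linear_0)
  have add_M: "x + y \<in> ?M" if "x \<in> ?M" "y \<in> ?M" for x y
    using that full_lattice_add[OF Y] tits_cone_add[OF zC] by (auto simp: Y_plus_def)
  have z_A: "z \<notin> A_in I \<alpha>"
  proof -
    obtain i where "i \<in> I" using assms(3) by fastforce
    then show ?thesis using z(2)[of i] by (force simp: A_in_def)
  qed
  have zero_A: "0 \<in> A_in I \<alpha>" using lin by (auto simp: A_in_def linear_0)
  have face: "x + y \<in> A_in I \<alpha> \<longleftrightarrow> x \<in> A_in I \<alpha> \<and> y \<in> A_in I \<alpha>"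
    if "x \<in> ?M" "y \<in> ?M" for x y
  proof
    assume "x + y \<in> A_in I \<alpha>"
    then show "x \<in> A_in I \<alpha> \<and> y \<in> A_in I \<alpha>"
      using that A_in_face_of_tits_cone[OF zC u, of x y] A_in_face_of_tits_cone[OF zC u, of y x]
      by (auto simp: Y_plus_def add.commute)
  next
    assume "x \<in> A_in I \<alpha> \<and> y \<in> A_in I \<alpha>"
    then show "x + y \<in> A_in I \<alpha>" using lin by (auto simp: A_in_def linear_add)
  qed
  have "?\<tau> \<in> hom_mon ?M UNIV"
    using add_M face by (auto simp: hom_mon_def)
  moreover have "?\<tau> \<notin> hom_mon ?M (UNIV - {0})"
  proof
    assume "?\<tau> \<in> hom_mon ?M (UNIV - {0})"
    then have "?\<tau> z \<in> UNIV - {0}" using z_M unfolding hom_mon_def by blast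
    then show False using z_M z_A by simp
  qed
  moreover have "?\<tau> \<noteq> (\<lambda>y\<in>?M. 0)"
  proof
    assume "?\<tau> = (\<lambda>y\<in>?M. 0)"
    then have "?\<tau> 0 = (\<lambda>y\<in>?M. 0) 0" by (rule fun_cong)
    then show False using zero_M zero_A by simp
  qed
  moreover have "(\<lambda>y\<in>?M. 0) \<in> hom_mon ?M (UNIV :: 'k set)"
    using add_M by (auto simp: hom_mon_def)
  moreover have "hom_mon ?M (UNIV - {0}) \<subseteq> hom_mon ?M (UNIV :: 'k set)"
    by (auto simp: hom_mon_def PiE_def)
  ultimately show ?thesis by blast
qed

end
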